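(* Let $G$ be a group, let $R$ be a $G$-graded commutative ring with nonzero unity, let $\phi: GI(R)\to GI(R)\cup\{\emptyset\}$ be a function, and let $P$ be a proper graded ideal of $R$ with $Grad(\phi(P))=\phi(Grad(P))$. If $P$ is a graded $\phi$-$r$-ideal of $R$, then $Grad(P)$ is a graded $\phi$-$r$-ideal of $R$.
   Context: $R=\bigoplus_{g\in G}R_g$ with additive subgroups $R_g$ satisfying $R_gR_h\subseteq R_{gh}$; $h(R)=\bigcup_{g\in G}R_g$ is the set of homogeneous elements, and each $x\in R$ is uniquely $x=\sum_{g}x_g$ with $x_g\in R_g$. An ideal $P$ is graded if $P=\bigoplus_{g\in G}(P\cap R_g)$, and $GI(R)$ is the set of all graded ideals of $R$. Standing convention: $\phi(P)\subseteq P$ for every graded ideal $P$. The graded radical of a proper graded ideal $I$ is $Grad(I)=\{x\in R: \text{for each } g\in G \text{ there is a positive integer } n_g \text{ with } x_g^{n_g}\in I\}$, which is a graded ideal (by the same formula, $Grad(\emptyset)=\emptyset$). For $x\in R$, $Ann(x)=\{a\in R: ax=0\}$. A proper graded ideal $P$ of $R$ is a graded $\phi$-$r$-ideal if whenever $x,y\in h(R)$ satisfy $xy\in P-\phi(P)$ (set difference) and $Ann(x)=\{0\}$, then $y\in P$. *)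

theory Defs
  imports "HOL-Algebra.Algebra"
begin

text \<open>An indexed family of elements is an extensional function on the index set, so that the
  family of components of an element is unique as a HOL function.\<close>

definition is_decomposition ::
    "('a, 'm) ring_scheme \<Rightarrow> 'i set \<Rightarrow> ('i \<Rightarrow> 'a set) \<Rightarrow> 'a \<Rightarrow> ('i \<Rightarrow> 'a) \<Rightarrow> bool" where
  "is_decomposition R I B x f \<longleftrightarrow>
     f \<in> (\<Pi>\<^sub>E i\<in>I. B i) \<and> finite {i \<in> I. f i \<noteq> \<zero>\<^bsub>R\<^esub>} \<and>
     x = finsum R f {i \<in> I. f i \<noteq> \<zero>\<^bsub>R\<^esub>}"

definition internal_direct_sum ::
    "('a, 'm) ring_scheme \<Rightarrow> 'i set \<Rightarrow> ('i \<Rightarrow> 'a set) \<Rightarrow> 'a set \<Rightarrow> bool" where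
  "internal_direct_sum R I B H \<longleftrightarrow>
     additive_subgroup H R \<and>
     (\<forall>i\<in>I. additive_subgroup (B i) R \<and> B i \<subseteq> H) \<and>
     (\<forall>x\<in>H. \<exists>!f. is_decomposition R I B x f)"

locale graded_cring = group G + cring R
  for G :: "('g, 'n) monoid_scheme" (structure) and R :: "('a, 'm) ring_scheme" (structure) +
  fixes A :: "'g \<Rightarrow> 'a set"
  assumes one_neq_zero: "\<one>\<^bsub>R\<^esub> \<noteq> \<zero>\<^bsub>R\<^esub>"
    and direct_sum: "internal_direct_sum R (carrier G) A (carrier R)"
    and grading_mult: "\<lbrakk>g \<in> carrier G; h \<in> carrier G; x \<in> A g; y \<in> A h\<rbrakk>
          \<Longrightarrow> x \<otimes>\<^bsub>R\<^esub> y \<in> A (g \<otimes>\<^bsub>G\<^esub> h)"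

definition homogeneous :: "('g, 'n) monoid_scheme \<Rightarrow> ('g \<Rightarrow> 'a set) \<Rightarrow> 'a set" where
  "homogeneous G A = (\<Union>g\<in>carrier G. A g)"

definition component ::
    "('g, 'n) monoid_scheme \<Rightarrow> ('a, 'm) ring_scheme \<Rightarrow> ('g \<Rightarrow> 'a set) \<Rightarrow> 'a \<Rightarrow> 'g \<Rightarrow> 'a" where
  "component G R A x = (THE f. is_decomposition R (carrier G) A x f)"

definition graded_ideal ::
    "('g, 'n) monoid_scheme \<Rightarrow> ('a, 'm) ring_scheme \<Rightarrow> ('g \<Rightarrow> 'a set) \<Rightarrow> 'a set \<Rightarrow> bool" where
  "graded_ideal G R A P \<longleftrightarrow>
     ideal P R \<and> internal_direct_sum R (carrier G) (\<lambda>g. P \<inter> A g) P"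

definition GI ::
    "('g, 'n) monoid_scheme \<Rightarrow> ('a, 'm) ring_scheme \<Rightarrow> ('g \<Rightarrow> 'a set) \<Rightarrow> 'a set set" where
  "GI G R A = {P. graded_ideal G R A P}"

text \<open>The formula is used for arbitrary subsets \<open>I\<close>; in particular it covers \<open>I = {}\<close>, where
  it yields the empty set because \<open>G\<close> has at least one element.\<close>

definition Grad ::
    "('g, 'n) monoid_scheme \<Rightarrow> ('a, 'm) ring_scheme \<Rightarrow> ('g \<Rightarrow> 'a set) \<Rightarrow> 'a set \<Rightarrow> 'a set" where
  "Grad G R A I =
     {x \<in> carrier R. \<forall>g\<in>carrier G. \<exists>n::nat. n > 0 \<and> component G R A x g [^]\<^bsub>R\<^esub> n \<in> I}"

definition Ann :: "('a, 'm) ring_scheme \<Rightarrow> 'a \<Rightarrow> 'a set" where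
  "Ann R x = {a \<in> carrier R. a \<otimes>\<^bsub>R\<^esub> x = \<zero>\<^bsub>R\<^esub>}"

definition graded_phi_r_ideal ::
    "('g, 'n) monoid_scheme \<Rightarrow> ('a, 'm) ring_scheme \<Rightarrow> ('g \<Rightarrow> 'a set) \<Rightarrow>
     ('a set \<Rightarrow> 'a set) \<Rightarrow> 'a set \<Rightarrow> bool" where
  "graded_phi_r_ideal G R A \<phi> P \<longleftrightarrow>
     graded_ideal G R A P \<and> P \<noteq> carrier R \<and>
     (\<forall>x\<in>homogeneous G A. \<forall>y\<in>homogeneous G A.
        x \<otimes>\<^bsub>R\<^esub> y \<in> P - \<phi> P \<and> Ann R x = {\<zero>\<^bsub>R\<^esub>} \<longrightarrow> y \<in> P)"

end

theory Submission
  imports Defs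
begin

text \<open>The graded radical of \<open>P\<close> consists of the elements all of whose components lie in
  the ordinary radical of \<open>P\<close>, and for any ideal \<open>J\<close> the elements with all components in \<open>J\<close>
  form a graded ideal contained in \<open>J\<close>. If \<open>x\<close>, \<open>y\<close> are homogeneous and \<open>x y\<close> lies in the graded
  radical of \<open>P\<close> but not in that of \<open>\<phi> P\<close>, then some power satisfies \<open>x^n y^n \<in> P - \<phi> P\<close>;
  as \<open>Ann (x^n) = 0\<close> when \<open>Ann x = 0\<close>, the hypothesis on \<open>P\<close> gives \<open>y^n \<in> P\<close>.\<close>

section \<open>Radicals, annihilators and finite sums in a commutative ring\<close>

definition radical :: "('a, 'm) ring_scheme \<Rightarrow> 'a set \<Rightarrow> 'a set" where
  "radical R I = {a \<in> carrier R. \<exists>n::nat. n > 0 \<and> a [^]\<^bsub>R\<^esub> n \<in> I}"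

context cring
begin

text \<open>This replaces the binomial theorem in showing that radicals are closed under sums. The
  factors of \<open>(a \<oplus> b) [^] (n + m)\<close> are expanded one at a time and absorbed into
  \<open>c\<close>, so \<open>c\<close> has to vary in the induction on
  \<open>n + m\<close>.\<close>

lemma add_pow_mult_mem_ideal:
  assumes "ideal I R" and ab: "a \<in> carrier R" "b \<in> carrier R"
  shows "c \<in> carrier R \<Longrightarrow> a [^] (n::nat) \<otimes> c \<in> I \<Longrightarrow> b [^] (m::nat) \<otimes> c \<in> I \<Longrightarrow>
    (a \<oplus> b) [^] (n + m) \<otimes> c \<in> I"
proof (induction "n + m" arbitrary: n m c)
  case 0
  then show ?case by simp
next
  case (Suc k)
  interpret I: ideal I R by fact
  note c = \<open>c \<in> carrier R\<close>
  show ?case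
  proof (cases "n = 0 \<or> m = 0")
    case True
    then have "c \<in> I" using Suc.prems by auto
    then show ?thesis using ab by (simp add: I.I_l_closed)
  next
    case False
    then obtain n' m' where nm: "n = Suc n'" "m = Suc m'"
      by (meson not0_implies_Suc)
    \<comment> \<open>Multiplying \<open>c\<close> by \<open>a\<close> lowers the exponent of
      \<open>a\<close> by one, and multiplying it by \<open>b\<close> lowers that of
      \<open>b\<close>. Either way the sum of exponents drops to \<open>k\<close>, so the induction
      hypothesis covers both summands of the expansion.\<close>
    have "a [^] n' \<otimes> (a \<otimes> c) \<in> I"
      using Suc.prems(2) ab c nm by (simp add: m_assoc)
    moreover have "b [^] m \<otimes> (a \<otimes> c) = a \<otimes> (b [^] m \<otimes> c)"
      using ab c by (simp add: m_lcomm)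
    then have "b [^] m \<otimes> (a \<otimes> c) \<in> I"
      using Suc.prems(3) ab by (simp add: I.I_l_closed)
    ultimately have 1: "(a \<oplus> b) [^] (n' + m) \<otimes> (a \<otimes> c) \<in> I"
      using Suc.hyps(2) nm ab c by (intro Suc.hyps(1)) auto
    have "b [^] m' \<otimes> (b \<otimes> c) \<in> I"
      using Suc.prems(3) ab c nm by (simp add: m_assoc)
    moreover have "a [^] n \<otimes> (b \<otimes> c) = b \<otimes> (a [^] n \<otimes> c)"
      using ab c by (simp add: m_lcomm)
    then have "a [^] n \<otimes> (b \<otimes> c) \<in> I"
      using Suc.prems(2) ab by (simp add: I.I_l_closed)
    ultimately have 2: "(a \<oplus> b) [^] (n + m') \<otimes> (b \<otimes> c) \<in> I"
      using Suc.hyps(2) nm ab c by (intro Suc.hyps(1)) auto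
    have "(a \<oplus> b) [^] (n + m) \<otimes> c =
        (a \<oplus> b) [^] (n' + m) \<otimes> (a \<otimes> c) \<oplus> (a \<oplus> b) [^] (n + m') \<otimes> (b \<otimes> c)"
      using ab c nm by (simp add: m_assoc l_distr r_distr)
    then show ?thesis using 1 2 I.a_closed by simp
  qed
qed

lemma ideal_radical:
  assumes "ideal I R"
  shows "ideal (radical R I) R"
proof -
  interpret I: ideal I R by fact
  have add: "a \<oplus> b \<in> radical R I" if "a \<in> radical R I" "b \<in> radical R I" for a b
  proof -
    from that obtain n m :: nat where "n > 0" "a [^] n \<in> I" "b [^] m \<in> I"
      and ab: "a \<in> carrier R" "b \<in> carrier R"
      unfolding radical_def by auto
    then have "(a \<oplus> b) [^] (n + m) \<in> I"
      using add_pow_mult_mem_ideal[OF assms ab one_closed, of n m] by simp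
    then show ?thesis
      using ab \<open>n > 0\<close> unfolding radical_def by (auto intro!: exI[of _ "n + m"])
  qed
  have mult: "r \<otimes> a \<in> radical R I" if "a \<in> radical R I" "r \<in> carrier R" for r a
    using that unfolding radical_def by (auto simp: nat_pow_distrib intro!: I.I_l_closed)
  show ?thesis
  proof (rule idealI)
    show "subgroup (radical R I) (add_monoid R)"
    proof (rule add.subgroupI)
      show "radical R I \<noteq> {}"
        using I.zero_closed by (auto simp: radical_def intro!: exI[of _ \<zero>] exI[of _ "1::nat"])
      show "\<ominus> a \<in> radical R I" if "a \<in> radical R I" for a
        \<comment> \<open>Negation is multiplication by \<open>\<ominus> \<one>\<close>.\<close>
        using mult[OF that, of "\<ominus> \<one>"] that by (simp add: radical_def l_minus)
    qed (auto simp: add, simp add: radical_def)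
  qed (use mult m_comm in \<open>auto simp: radical_def ring_axioms\<close>)
qed

text \<open>A non-zero-divisor can be cancelled from a power one factor at a time.\<close>

lemma Ann_pow:
  assumes "x \<in> carrier R" "Ann R x = {\<zero>}"
  shows "Ann R (x [^] (n::nat)) = {\<zero>}"
proof (induction n)
  case 0
  show ?case by (auto simp: Ann_def)
next
  case (Suc n)
  have "a = \<zero>" if a: "a \<in> carrier R" "a \<otimes> x [^] Suc n = \<zero>" for a
  proof -
    have "a \<otimes> x [^] n \<in> Ann R x"
      using a assms(1) by (simp add: Ann_def m_assoc)
    then have "a \<otimes> x [^] n = \<zero>" using assms(2) by blast
    then have "a \<in> Ann R (x [^] n)" using a by (simp add: Ann_def)
    then show ?thesis using Suc by simp
  qed
  then show ?case using assms(1) by (auto simp: Ann_def)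
qed

text \<open>For infinite \<open>S\<close> the sum is \<open>\<zero>\<close> by convention, which
  lies in \<open>H\<close>.\<close>

lemma finsum_mem:
  assumes "\<zero> \<in> H" "H \<subseteq> carrier R" "\<And>a b. a \<in> H \<Longrightarrow> b \<in> H \<Longrightarrow> a \<oplus> b \<in> H"
    and "f \<in> S \<rightarrow> H"
  shows "finsum R f S \<in> H"
  using assms(4)
proof (induction S rule: infinite_finite_induct)
  case (insert s S)
  then have "f \<in> S \<rightarrow> carrier R" "f s \<in> carrier R" using assms(2) by auto
  with insert show ?case by (simp add: assms(3))
qed (use assms(1) in auto)

end

text \<open>Same content as \<open>graded_cring\<close>, whose two unqualified parents have clashing fact names.\<close>

locale graded_comm_ring = G: group G + R: cring R
  for G :: "('g, 'n) monoid_scheme" and R :: "('a, 'm) ring_scheme" +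
  fixes A :: "'g \<Rightarrow> 'a set"
  assumes direct_sum: "internal_direct_sum R (carrier G) A (carrier R)"
    and grading_mult: "\<lbrakk>g \<in> carrier G; h \<in> carrier G; x \<in> A g; y \<in> A h\<rbrakk>
          \<Longrightarrow> x \<otimes>\<^bsub>R\<^esub> y \<in> A (g \<otimes>\<^bsub>G\<^esub> h)"
begin

section \<open>Homogeneous components of an element\<close>

abbreviation comp :: "'a \<Rightarrow> 'g \<Rightarrow> 'a" where
  "comp \<equiv> component G R A"

text \<open>For an ideal \<open>J\<close> this is the largest graded ideal contained in
  \<open>J\<close>. The description by components matches the shape of \<open>Grad\<close>.\<close>

definition homogeneous_core :: "'a set \<Rightarrow> 'a set" where
  "homogeneous_core J = {x \<in> carrier R. \<forall>g\<in>carrier G. comp x g \<in> J}"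

lemma A_subgroup: "g \<in> carrier G \<Longrightarrow> additive_subgroup (A g) R"
  using direct_sum by (simp add: internal_direct_sum_def)

lemma A_carrier: "g \<in> carrier G \<Longrightarrow> a \<in> A g \<Longrightarrow> a \<in> carrier R"
  using direct_sum by (auto simp: internal_direct_sum_def)

lemma A_zero: "g \<in> carrier G \<Longrightarrow> \<zero>\<^bsub>R\<^esub> \<in> A g"
  by (simp add: A_subgroup additive_subgroup.zero_closed)

lemma homogeneous_carrier: "x \<in> homogeneous G A \<Longrightarrow> x \<in> carrier R"
  using A_carrier by (auto simp: homogeneous_def)

lemma comp_unique:
  "x \<in> carrier R \<Longrightarrow> is_decomposition R (carrier G) A x f \<Longrightarrow> comp x = f"
  using direct_sum unfolding component_def internal_direct_sum_def
  by (metis (no_types, lifting) the1_equality)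

lemma is_decomposition_comp:
  assumes "x \<in> carrier R"
  shows "is_decomposition R (carrier G) A x (comp x)"
proof -
  have "\<exists>!f. is_decomposition R (carrier G) A x f"
    using direct_sum assms by (simp add: internal_direct_sum_def)
  then show ?thesis unfolding component_def by (rule theI')
qed

lemma comp_mem: "x \<in> carrier R \<Longrightarrow> g \<in> carrier G \<Longrightarrow> comp x g \<in> A g"
  using is_decomposition_comp[of x] by (auto simp: is_decomposition_def)

text \<open>Extending \<open>f\<close> by zero gives a decomposition of the sum, and decompositions
  are unique.\<close>

lemma comp_finsum:
  assumes S: "finite S" "S \<subseteq> carrier G" and f: "\<And>g. g \<in> S \<Longrightarrow> f g \<in> A g"
    and "g \<in> carrier G"
  shows "comp (finsum R f S) g = (if g \<in> S then f g else \<zero>\<^bsub>R\<^esub>)"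
proof -
  \<comment> \<open>Decompositions are extensional on \<open>carrier G\<close>, hence the restricted
    abstraction. The support of \<open>F\<close> can be smaller than \<open>S\<close>, as
    \<open>f\<close> may vanish on \<open>S\<close>.\<close>
  define F where "F = (\<lambda>h\<in>carrier G. if h \<in> S then f h else \<zero>\<^bsub>R\<^esub>)"
  let ?T = "{h \<in> carrier G. F h \<noteq> \<zero>\<^bsub>R\<^esub>}"
  have T: "?T \<subseteq> S" by (auto simp: F_def)
  have fR: "f \<in> S \<rightarrow> carrier R" using S f A_carrier by blast
  have "finsum R F ?T = finsum R f S"
    using S T fR
    by (intro R.add.finprod_mono_neutral_cong_left) (auto simp: F_def)
  moreover have "F \<in> (\<Pi>\<^sub>E h\<in>carrier G. A h)"
    using f A_zero by (auto simp: F_def)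
  moreover have "finite ?T" using T S finite_subset by blast
  ultimately have "is_decomposition R (carrier G) A (finsum R f S) F"
    by (simp add: is_decomposition_def)
  then have "comp (finsum R f S) = F"
    using fR comp_unique by simp
  then show ?thesis using assms(4) by (simp add: F_def)
qed

lemma comp_homogeneous:
  assumes "g \<in> carrier G" "a \<in> A g" "h \<in> carrier G"
  shows "comp a h = (if h = g then a else \<zero>\<^bsub>R\<^esub>)"
proof -
  have "finsum R (\<lambda>_. a) {g} = a" using A_carrier[OF assms(1,2)] by simp
  then show ?thesis using comp_finsum[of "{g}" "\<lambda>_. a" h] assms by simp
qed

text \<open>\<open>S\<close> may exceed the support, so that two elements can be expanded over a
  common index set.\<close>

lemma finsum_comp:
  assumes "x \<in> carrier R" "finite S" "{g \<in> carrier G. comp x g \<noteq> \<zero>\<^bsub>R\<^esub>} \<subseteq> S" "S \<subseteq> carrier G"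
  shows "finsum R (comp x) S = x"
proof -
  have "x = finsum R (comp x) {g \<in> carrier G. comp x g \<noteq> \<zero>\<^bsub>R\<^esub>}"
    using is_decomposition_comp[OF assms(1)] by (simp add: is_decomposition_def)
  also have "\<dots> = finsum R (comp x) S"
    using assms A_carrier comp_mem
    by (intro R.add.finprod_mono_neutral_cong_left) auto
  finally show ?thesis by simp
qed

lemma finite_support_comp: "x \<in> carrier R \<Longrightarrow> finite {g \<in> carrier G. comp x g \<noteq> \<zero>\<^bsub>R\<^esub>}"
  using is_decomposition_comp[of x] by (simp add: is_decomposition_def)

lemma comp_carrier: "x \<in> carrier R \<Longrightarrow> g \<in> carrier G \<Longrightarrow> comp x g \<in> carrier R"
  using A_carrier comp_mem by blast

lemma comp_add:
  assumes "x \<in> carrier R" "y \<in> carrier R" "g \<in> carrier G"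
  shows "comp (x \<oplus>\<^bsub>R\<^esub> y) g = comp x g \<oplus>\<^bsub>R\<^esub> comp y g"
proof -
  define S where "S = {g \<in> carrier G. comp x g \<noteq> \<zero>\<^bsub>R\<^esub>} \<union> {g \<in> carrier G. comp y g \<noteq> \<zero>\<^bsub>R\<^esub>}"
  have S: "finite S" "S \<subseteq> carrier G"
    using assms finite_support_comp by (auto simp: S_def)
  have "x \<oplus>\<^bsub>R\<^esub> y = finsum R (comp x) S \<oplus>\<^bsub>R\<^esub> finsum R (comp y) S"
    using assms S by (simp add: finsum_comp S_def)
  also have "\<dots> = finsum R (\<lambda>h. comp x h \<oplus>\<^bsub>R\<^esub> comp y h) S"
    using assms S comp_carrier by (intro R.finsum_addf[symmetric]) auto
  finally have "comp (x \<oplus>\<^bsub>R\<^esub> y) g = (if g \<in> S then comp x g \<oplus>\<^bsub>R\<^esub> comp y g else \<zero>\<^bsub>R\<^esub>)"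
    using comp_finsum[OF S, of "\<lambda>h. comp x h \<oplus>\<^bsub>R\<^esub> comp y h" g] assms S
      additive_subgroup.a_closed[OF A_subgroup] comp_mem
    by (simp add: subset_iff)
  then show ?thesis using assms by (auto simp: S_def)
qed

section \<open>The largest graded ideal inside an ideal\<close>

lemma homogeneous_core_homogeneous:
  assumes "ideal J R" "g \<in> carrier G" "a \<in> A g"
  shows "a \<in> homogeneous_core J \<longleftrightarrow> a \<in> J"
proof -
  interpret J: ideal J R by fact
  show ?thesis
    using assms(2,3) A_carrier by (auto simp: homogeneous_core_def comp_homogeneous)
qed

lemma homogeneous_core_subset:
  assumes "ideal J R"
  shows "homogeneous_core J \<subseteq> J"
proof
  interpret J: ideal J R by fact
  fix x assume x: "x \<in> homogeneous_core J"
  then have xR: "x \<in> carrier R" by (simp add: homogeneous_core_def)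
  have "finsum R (comp x) {g \<in> carrier G. comp x g \<noteq> \<zero>\<^bsub>R\<^esub>} \<in> J"
    using x by (intro R.finsum_mem) (auto simp: homogeneous_core_def)
  then show "x \<in> J" using finsum_comp[OF xR finite_support_comp[OF xR]] by simp
qed

text \<open>Sums are handled componentwise. For products, both factors are split into components,
  which reduces the claim to products of homogeneous elements.\<close>

lemma ideal_homogeneous_core:
  assumes "ideal J R"
  shows "ideal (homogeneous_core J) R"
proof -
  interpret J: ideal J R by fact
  let ?H = "homogeneous_core J"
  have sub: "?H \<subseteq> carrier R" by (auto simp: homogeneous_core_def)
  have zero: "\<zero>\<^bsub>R\<^esub> \<in> ?H"
    using homogeneous_core_homogeneous[OF assms G.one_closed] A_zero by simp
  have add: "a \<oplus>\<^bsub>R\<^esub> b \<in> ?H" if "a \<in> ?H" "b \<in> ?H" for a b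
    using that by (simp add: homogeneous_core_def comp_add)
  have mult: "r \<otimes>\<^bsub>R\<^esub> x \<in> ?H" if x: "x \<in> ?H" and r: "r \<in> carrier R" for r x
  proof -
    let ?S = "\<lambda>x. {g \<in> carrier G. comp x g \<noteq> \<zero>\<^bsub>R\<^esub>}"
    have xR: "x \<in> carrier R" using x sub by blast
    \<comment> \<open>Such a product is homogeneous of degree \<open>g \<otimes> h\<close>, so lying
      in the core amounts to lying in \<open>J\<close>.\<close>
    have hom: "comp r g \<otimes>\<^bsub>R\<^esub> comp x h \<in> ?H" if gh: "g \<in> carrier G" "h \<in> carrier G" for g h
    proof -
      have "comp r g \<otimes>\<^bsub>R\<^esub> comp x h \<in> J"
        using x gh r by (auto simp: homogeneous_core_def comp_carrier intro: J.I_l_closed)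
      moreover have "comp r g \<otimes>\<^bsub>R\<^esub> comp x h \<in> A (g \<otimes>\<^bsub>G\<^esub> h)"
        using gh r xR by (simp add: grading_mult comp_mem)
      ultimately show ?thesis
        using gh homogeneous_core_homogeneous[OF assms] G.m_closed by blast
    qed
    \<comment> \<open>First \<open>x\<close> is expanded with a single component of \<open>r\<close>
      fixed; the sum over the components of \<open>r\<close> follows afterwards.\<close>
    have "comp r g \<otimes>\<^bsub>R\<^esub> x \<in> ?H" if g: "g \<in> carrier G" for g
    proof -
      have "comp r g \<otimes>\<^bsub>R\<^esub> x = comp r g \<otimes>\<^bsub>R\<^esub> finsum R (comp x) (?S x)"
        using xR finsum_comp finite_support_comp by simp
      also have "\<dots> = finsum R (\<lambda>h. comp r g \<otimes>\<^bsub>R\<^esub> comp x h) (?S x)"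
        using xR r g comp_carrier finite_support_comp by (intro R.finsum_rdistr) auto
      also have "\<dots> \<in> ?H"
        using hom g by (intro R.finsum_mem zero sub add) auto
      finally show ?thesis .
    qed
    then have "finsum R (\<lambda>g. comp r g \<otimes>\<^bsub>R\<^esub> x) (?S r) \<in> ?H"
      by (intro R.finsum_mem zero sub add) auto
    also have "finsum R (\<lambda>g. comp r g \<otimes>\<^bsub>R\<^esub> x) (?S r) = finsum R (comp r) (?S r) \<otimes>\<^bsub>R\<^esub> x"
      using xR r comp_carrier finite_support_comp by (intro R.finsum_ldistr[symmetric]) auto
    also have "finsum R (comp r) (?S r) = r"
      using r finsum_comp finite_support_comp by simp
    finally show ?thesis .
  qed
  show ?thesis
  proof (rule idealI)
    show "subgroup ?H (add_monoid R)"
    proof (rule R.add.subgroupI)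
      show "\<ominus>\<^bsub>R\<^esub> a \<in> ?H" if "a \<in> ?H" for a
        using mult[OF that, of "\<ominus>\<^bsub>R\<^esub> \<one>\<^bsub>R\<^esub>"] that sub by (auto simp: R.l_minus)
    qed (use sub zero add in auto)
    show "x \<otimes>\<^bsub>R\<^esub> r \<in> ?H" if "x \<in> ?H" "r \<in> carrier R" for x r
      using mult[OF that] that sub R.m_comm by (metis subsetD)
  qed (use mult R.ring_axioms in auto)
qed

text \<open>The components of an element of the core lie in the core again, which gives existence of
  the decomposition; uniqueness is inherited from \<open>R\<close>.\<close>

lemma graded_ideal_homogeneous_core:
  assumes "ideal J R"
  shows "graded_ideal G R A (homogeneous_core J)"
proof -
  let ?H = "homogeneous_core J"
  interpret H: ideal ?H R using ideal_homogeneous_core[OF assms] .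
  have "additive_subgroup (?H \<inter> A g) R" if "g \<in> carrier G" for g
    using R.add.subgroups_Inter_pair[OF H.a_subgroup] A_subgroup[OF that]
    by (simp add: additive_subgroup_def)
  moreover have "\<exists>!f. is_decomposition R (carrier G) (\<lambda>g. ?H \<inter> A g) x f" if x: "x \<in> ?H" for x
  proof (rule ex1I)
    have xR: "x \<in> carrier R" using x by (rule H.a_Hcarr)
    have "comp x g \<in> ?H" if g: "g \<in> carrier G" for g
    proof -
      have "comp x g \<in> J" using x g unfolding homogeneous_core_def by blast
      then show ?thesis
        using homogeneous_core_homogeneous[OF assms g comp_mem[OF xR g]] by blast
    qed
    then show "is_decomposition R (carrier G) (\<lambda>g. ?H \<inter> A g) x (comp x)"
      using is_decomposition_comp[OF xR] by (auto simp: is_decomposition_def PiE_iff)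
    show "f = comp x" if "is_decomposition R (carrier G) (\<lambda>g. ?H \<inter> A g) x f" for f
    proof -
      have "is_decomposition R (carrier G) A x f"
        using that by (auto simp: is_decomposition_def PiE_iff)
      then show ?thesis using comp_unique[OF xR] by simp
    qed
  qed
  ultimately show ?thesis
    using H.ideal_axioms H.additive_subgroup_axioms
    by (simp add: graded_ideal_def internal_direct_sum_def)
qed

section \<open>The graded radical\<close>

lemma Grad_eq_homogeneous_core: "Grad G R A I = homogeneous_core (radical R I)"
  by (auto simp: Grad_def homogeneous_core_def radical_def comp_carrier)

lemma homogeneous_mult:
  "x \<in> homogeneous G A \<Longrightarrow> y \<in> homogeneous G A \<Longrightarrow> x \<otimes>\<^bsub>R\<^esub> y \<in> homogeneous G A"
  using grading_mult G.m_closed unfolding homogeneous_def by blast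

lemma homogeneous_pow:
  assumes "x \<in> homogeneous G A" "n > 0"
  shows "x [^]\<^bsub>R\<^esub> (n::nat) \<in> homogeneous G A"
  using assms(2)
proof (induction n rule: nat_induct_non_zero)
  case 1
  then show ?case using assms(1) homogeneous_carrier by simp
next
  case (Suc n)
  then show ?case using assms(1) homogeneous_mult by simp
qed

text \<open>A homogeneous element has at most one nonzero component, itself, so a single exponent
  decides membership.\<close>

lemma Grad_homogeneous:
  assumes "ideal I R" "x \<in> homogeneous G A"
  shows "x \<in> Grad G R A I \<longleftrightarrow> (\<exists>n::nat. n > 0 \<and> x [^]\<^bsub>R\<^esub> n \<in> I)"
proof -
  obtain g where "g \<in> carrier G" "x \<in> A g"
    using assms(2) by (auto simp: homogeneous_def)
  then show ?thesis
    using homogeneous_core_homogeneous[OF R.ideal_radical[OF assms(1)]] A_carrier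
    by (simp add: Grad_eq_homogeneous_core radical_def)
qed

lemma graded_ideal_Grad: "ideal I R \<Longrightarrow> graded_ideal G R A (Grad G R A I)"
  by (simp add: Grad_eq_homogeneous_core graded_ideal_homogeneous_core R.ideal_radical)

text \<open>Every power of \<open>\<one>\<close> is \<open>\<one>\<close>, so a radical containing
  \<open>\<one>\<close> forces \<open>\<one>\<close> into \<open>I\<close>.\<close>

lemma Grad_proper:
  assumes "ideal I R" "I \<noteq> carrier R"
  shows "Grad G R A I \<noteq> carrier R"
proof
  assume "Grad G R A I = carrier R"
  then have "\<one>\<^bsub>R\<^esub> \<in> radical R I"
    using homogeneous_core_subset[OF R.ideal_radical[OF assms(1)]]
    by (auto simp: Grad_eq_homogeneous_core)
  then have "\<one>\<^bsub>R\<^esub> \<in> I" by (auto simp: radical_def)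
  then show False using assms ideal.one_imp_carrier by blast
qed

end

section \<open>Passing from \<open>P\<close> to its graded radical\<close>

theorem theorem2p8:
  fixes G :: "('g, 'n) monoid_scheme" and R :: "('a, 'm) ring_scheme"
    and A :: "'g \<Rightarrow> 'a set" and \<phi> :: "'a set \<Rightarrow> 'a set" and P :: "'a set"
  assumes "graded_cring G R A"
    and "\<phi> \<in> GI G R A \<rightarrow> GI G R A \<union> {{}}"
    and "\<And>I. I \<in> GI G R A \<Longrightarrow> \<phi> I \<subseteq> I"
    and "P \<in> GI G R A" and "P \<noteq> carrier R"
    and "Grad G R A (\<phi> P) = \<phi> (Grad G R A P)"
    and "graded_phi_r_ideal G R A \<phi> P"
  shows "graded_phi_r_ideal G R A \<phi> (Grad G R A P)"
proof -
  interpret graded_comm_ring G R A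
    using assms(1)
    by (simp add: graded_cring_def graded_cring_axioms_def graded_comm_ring_def
        graded_comm_ring_axioms_def)
  have P: "ideal P R" using assms(4) by (simp add: GI_def graded_ideal_def)
  have phiP: "\<phi> P = {} \<or> ideal (\<phi> P) R"
    using assms(2,4) by (auto simp: GI_def graded_ideal_def)
  have "y \<in> Grad G R A P"
    if x: "x \<in> homogeneous G A" and y: "y \<in> homogeneous G A"
      and xy: "x \<otimes>\<^bsub>R\<^esub> y \<in> Grad G R A P - \<phi> (Grad G R A P)" and ann: "Ann R x = {\<zero>\<^bsub>R\<^esub>}"
    for x y
  proof -
    have xyh: "x \<otimes>\<^bsub>R\<^esub> y \<in> homogeneous G A" using x y homogeneous_mult by blast
    obtain n :: nat where n: "n > 0" "(x \<otimes>\<^bsub>R\<^esub> y) [^]\<^bsub>R\<^esub> n \<in> P"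
      using xy Grad_homogeneous[OF P xyh] by blast
    \<comment> \<open>If \<open>\<phi> P\<close> is an ideal, a power of the product in it would put
      the product into \<open>Grad G R A (\<phi> P)\<close>, which equals
      \<open>\<phi> (Grad G R A P)\<close> and so excludes it. If \<open>\<phi> P\<close> is empty,
      there is nothing to show.\<close>
    have "(x \<otimes>\<^bsub>R\<^esub> y) [^]\<^bsub>R\<^esub> n \<notin> \<phi> P"
      using phiP xy n(1) Grad_homogeneous[OF _ xyh] assms(6) by blast
    then have "x [^]\<^bsub>R\<^esub> n \<otimes>\<^bsub>R\<^esub> y [^]\<^bsub>R\<^esub> n \<in> P - \<phi> P"
      using n(2) x y homogeneous_carrier by (simp add: R.nat_pow_distrib)
    moreover have "Ann R (x [^]\<^bsub>R\<^esub> n) = {\<zero>\<^bsub>R\<^esub>}"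
      using R.Ann_pow ann x homogeneous_carrier by blast
    \<comment> \<open>The defining condition on \<open>P\<close> is applied to the homogeneous pair
      of \<open>n\<close>-th powers of \<open>x\<close> and \<open>y\<close>.\<close>
    ultimately have "y [^]\<^bsub>R\<^esub> n \<in> P"
      using assms(7) homogeneous_pow[OF x n(1)] homogeneous_pow[OF y n(1)]
      by (auto simp: graded_phi_r_ideal_def)
    then show ?thesis using n(1) Grad_homogeneous[OF P y] by blast
  qed
  then show ?thesis
    using graded_ideal_Grad[OF P] Grad_proper[OF P assms(5)]
    by (simp add: graded_phi_r_ideal_def)
qed

end
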